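(* Let $R$ and $R'$ be rings. If $R'$ is $2$-torsion free and semiprime, then every surjective Jordan homomorphism $\varphi:R\to R'$ is the sum of a homomorphism and an antihomomorphism on the commutator ideal $K$ of $R$.
   Context: Rings are associative and not necessarily unital; ideals are two-sided, and the ideal generated by a set is the smallest ideal containing it. Homomorphisms and antihomomorphisms are additive maps with $\alpha(xy)=\alpha(x)\alpha(y)$, respectively $\alpha(xy)=\alpha(y)\alpha(x)$. A ring is $2$-torsion free if $2x=0$ implies $x=0$; it is semiprime if it has no nonzero nilpotent ideals. An additive map $\varphi:R\to R'$ is a Jordan homomorphism if $\varphi(x^2)=\varphi(x)^2$ and $\varphi(xyx)=\varphi(x)\varphi(y)\varphi(x)$ for all $x,y\in R$. Let $R_\varphi'$ denote the subring of $R'$ generated by $\varphi(R)$. The commutator ideal $K$ of $R$ is the ideal of $R$ generated by all $[x,y]=xy-yx$, $x,y\in R$. Let $I$ be an ideal of $R$. A Jordan homomorphism $\varphi:R\to R'$ is the sum of a homomorphism and an antihomomorphism on $I$ if there exist a homomorphism $\varphi_1:I\to R_\varphi'$ and an antihomomorphism $\varphi_2:I\to R_\varphi'$ such that: (a) $\varphi|_I=\varphi_1+\varphi_2$; (b) $R_\varphi'$ has ideals $J_1$ and $J_2$ with $\varphi_1(I)\subseteq J_1$, $\varphi_2(I)\subseteq J_2$ and $J_1\cap J_2=\{0\}$; (c) $\varphi_1(ux)=\varphi_1(u)\varphi(x)$ and $\varphi_1(xu)=\varphi(x)\varphi_1(u)$ for all $u\in I$, $x\in R$; (d) $\varphi_2(ux)=\varphi(x)\varphi_2(u)$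 and $\varphi_2(xu)=\varphi_2(u)\varphi(x)$ for all $u\in I$, $x\in R$. *)

theory Defs
  imports Complex_Main
begin

text \<open>
  A ring in the sense of the class \<open>ring\<close> is associative and need not have a unit.
  The rings \<open>R\<close> and \<open>R'\<close> are types of this class; subrings and ideals are sets.
\<close>

definition additive_subgroup :: "'a::ring set \<Rightarrow> bool" where
  "additive_subgroup A \<longleftrightarrow> 0 \<in> A \<and> (\<forall>x\<in>A. \<forall>y\<in>A. x - y \<in> A)"

definition is_subring :: "'a::ring set \<Rightarrow> bool" where
  "is_subring S \<longleftrightarrow> additive_subgroup S \<and> (\<forall>x\<in>S. \<forall>y\<in>S. x * y \<in> S)"

text \<open>Two-sided ideals of a subring \<open>S\<close>; ideals of the whole ring are the case \<open>S = UNIV\<close>.\<close>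

definition ideal_of :: "'a::ring set \<Rightarrow> 'a set \<Rightarrow> bool" where
  "ideal_of S I \<longleftrightarrow>
     I \<subseteq> S \<and> additive_subgroup I \<and> (\<forall>u\<in>I. \<forall>x\<in>S. u * x \<in> I \<and> x * u \<in> I)"

definition generated_subring :: "'a::ring set \<Rightarrow> 'a set" where
  "generated_subring X = is_subring hull X"

definition generated_ideal :: "'a::ring set \<Rightarrow> 'a set" where
  "generated_ideal X = ideal_of UNIV hull X"

definition commutator_ideal :: "'a::ring set" where
  "commutator_ideal = generated_ideal {x * y - y * x | x y. True}"

definition ideal_product :: "'a::ring set \<Rightarrow> 'a set \<Rightarrow> 'a set" where
  "ideal_product I J = additive_subgroup hull {x * y | x y. x \<in> I \<and> y \<in> J}"

text \<open>
  Without a unit there is no natural zeroth power of an ideal, so the exponent is shifted: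
  \<open>ideal_power_Suc I n\<close> is the power of \<open>I\<close> with exponent \<open>n + 1\<close>.
\<close>

primrec ideal_power_Suc :: "'a::ring set \<Rightarrow> nat \<Rightarrow> 'a set" where
  "ideal_power_Suc I 0 = I"
| "ideal_power_Suc I (Suc n) = ideal_product (ideal_power_Suc I n) I"

definition nilpotent_ideal :: "'a::ring set \<Rightarrow> bool" where
  "nilpotent_ideal I \<longleftrightarrow> ideal_of UNIV I \<and> (\<exists>n. ideal_power_Suc I n = {0})"

definition semiprime_ring :: "'a::ring itself \<Rightarrow> bool" where
  "semiprime_ring _ \<longleftrightarrow> (\<forall>I::'a set. nilpotent_ideal I \<longrightarrow> I = {0})"

definition two_torsion_free :: "'a::ring itself \<Rightarrow> bool" where
  "two_torsion_free _ \<longleftrightarrow> (\<forall>x::'a. x + x = 0 \<longrightarrow> x = 0)"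

definition jordan_hom :: "('a::ring \<Rightarrow> 'b::ring) \<Rightarrow> bool" where
  "jordan_hom \<phi> \<longleftrightarrow> additive \<phi> \<and> (\<forall>x. \<phi> (x * x) = \<phi> x * \<phi> x) \<and>
     (\<forall>x y. \<phi> (x * y * x) = \<phi> x * \<phi> y * \<phi> x)"

text \<open>
  Maps defined on a subring \<open>A\<close> are represented by total functions whose values
  outside \<open>A\<close> are irrelevant.
\<close>

definition ring_hom_on ::
  "'a::ring set \<Rightarrow> 'b::ring set \<Rightarrow> ('a \<Rightarrow> 'b) \<Rightarrow> bool" where
  "ring_hom_on A B \<alpha> \<longleftrightarrow> \<alpha> ` A \<subseteq> B \<and>
     (\<forall>x\<in>A. \<forall>y\<in>A. \<alpha> (x + y) = \<alpha> x + \<alpha> y \<and> \<alpha> (x * y) = \<alpha> x * \<alpha> y)"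

definition ring_antihom_on ::
  "'a::ring set \<Rightarrow> 'b::ring set \<Rightarrow> ('a \<Rightarrow> 'b) \<Rightarrow> bool" where
  "ring_antihom_on A B \<alpha> \<longleftrightarrow> \<alpha> ` A \<subseteq> B \<and>
     (\<forall>x\<in>A. \<forall>y\<in>A. \<alpha> (x + y) = \<alpha> x + \<alpha> y \<and> \<alpha> (x * y) = \<alpha> y * \<alpha> x)"

text \<open>
  The notion below is intended for a Jordan homomorphism \<open>\<phi>\<close> and an ideal \<open>I\<close> of its
  domain.
\<close>

definition sum_of_hom_and_antihom_on ::
  "('a::ring \<Rightarrow> 'b::ring) \<Rightarrow> 'a set \<Rightarrow> bool" where
  "sum_of_hom_and_antihom_on \<phi> I \<longleftrightarrow>
     (\<exists>\<phi>\<^sub>1 \<phi>\<^sub>2.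
        ring_hom_on I (generated_subring (range \<phi>)) \<phi>\<^sub>1 \<and>
        ring_antihom_on I (generated_subring (range \<phi>)) \<phi>\<^sub>2 \<and>
        (\<forall>u\<in>I. \<phi> u = \<phi>\<^sub>1 u + \<phi>\<^sub>2 u) \<and>
        (\<exists>J\<^sub>1 J\<^sub>2. ideal_of (generated_subring (range \<phi>)) J\<^sub>1 \<and>
                 ideal_of (generated_subring (range \<phi>)) J\<^sub>2 \<and>
                 \<phi>\<^sub>1 ` I \<subseteq> J\<^sub>1 \<and> \<phi>\<^sub>2 ` I \<subseteq> J\<^sub>2 \<and> J\<^sub>1 \<inter> J\<^sub>2 = {0}) \<and>
        (\<forall>u\<in>I. \<forall>x. \<phi>\<^sub>1 (u * x) = \<phi>\<^sub>1 u * \<phi> x \<and> \<phi>\<^sub>1 (x * u) = \<phi> x * \<phi>\<^sub>1 u) \<and>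
        (\<forall>u\<in>I. \<forall>x. \<phi>\<^sub>2 (u * x) = \<phi> x * \<phi>\<^sub>2 u \<and> \<phi>\<^sub>2 (x * u) = \<phi>\<^sub>2 u * \<phi> x))"

end

theory Submission
  imports Defs
begin

text \<open>
  Put \<open>\<delta> x y = \<phi> (x y) - \<phi> x \<phi> y\<close> and \<open>\<epsilon> x y = \<phi> (x y) - \<phi> y \<phi> x\<close>. Computing
  \<open>\<phi> (x y w y x + y x w x y)\<close> in two ways gives \<open>\<delta> x y s \<epsilon> x y + \<epsilon> x y s \<delta> x y = 0\<close> for all
  \<open>s\<close> in \<open>R'\<close>, and semiprimeness together with linearization upgrades this to
  \<open>\<delta> x y s \<epsilon> u v = 0 = \<epsilon> u v s \<delta> x y\<close>. Hence there are ideals \<open>D\<close> and \<open>E\<close> of \<open>R'\<close> with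
  \<open>D \<inter> E = 0\<close> that contain all \<open>\<delta> x y\<close> and all \<open>\<epsilon> x y\<close>, respectively. Thus \<open>\<phi>\<close> is a homomorphism
  modulo \<open>D\<close> and an antihomomorphism modulo \<open>E\<close>, so the preimage of \<open>D + E\<close> is an ideal; it
  contains the commutators because \<open>\<phi> (x y - y x) = \<delta> x y + \<epsilon> x y\<close>. On the commutator ideal,
  \<open>\<phi>\<^sub>1\<close> and \<open>\<phi>\<^sub>2\<close> are the components of \<open>\<phi>\<close> in \<open>E\<close> and \<open>D\<close>.
\<close>

section \<open>Semiprime rings\<close>

lemma additive_subgroup_0: "additive_subgroup A \<Longrightarrow> 0 \<in> A"
  and additive_subgroup_diff: "additive_subgroup A \<Longrightarrow> x \<in> A \<Longrightarrow> y \<in> A \<Longrightarrow> x - y \<in> A"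
  by (auto simp: additive_subgroup_def)

lemma additive_subgroup_add:
  assumes "additive_subgroup A" "x \<in> A" "y \<in> A"
  shows "x + y \<in> A"
proof -
  have "x - (0 - y) \<in> A"
    using assms by (intro additive_subgroup_diff additive_subgroup_0)
  then show ?thesis by simp
qed

lemma ideal_of_UNIV_iff:
  "ideal_of UNIV I \<longleftrightarrow> additive_subgroup I \<and> (\<forall>u\<in>I. \<forall>x. u * x \<in> I \<and> x * u \<in> I)"
  by (simp add: ideal_of_def)

lemma ideal_of_generated_ideal: "ideal_of UNIV (generated_ideal X)"
  unfolding generated_ideal_def
  by (rule hull_in) (auto simp: ideal_of_def additive_subgroup_def)

lemma generated_ideal_superset: "X \<subseteq> generated_ideal X"
  by (simp add: generated_ideal_def hull_subset)

lemma generated_ideal_minimal: "X \<subseteq> I \<Longrightarrow> ideal_of UNIV I \<Longrightarrow> generated_ideal X \<subseteq> I"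
  by (simp add: generated_ideal_def hull_minimal)

lemma additive_subgroup_singleton_0: "additive_subgroup {0}"
  by (simp add: additive_subgroup_def)

lemma ideal_product_eq_0:
  assumes "\<And>x y. x \<in> I \<Longrightarrow> y \<in> J \<Longrightarrow> x * y = 0"
  shows "ideal_product I J = {0}"
proof
  show "ideal_product I J \<subseteq> {0}"
    unfolding ideal_product_def
    by (rule hull_minimal) (use assms additive_subgroup_singleton_0 in auto)
  have "additive_subgroup (ideal_product I J)"
    unfolding ideal_product_def by (rule hull_in) (auto simp: additive_subgroup_def)
  then show "{0} \<subseteq> ideal_product I J"
    by (simp add: additive_subgroup_0)
qed

text \<open>The free factor \<open>s\<close> makes this an ideal for an arbitrary set
  \<open>T\<close>, with no unit required. Imposing both orders makes the relation between
  \<open>d\<close> and \<open>t\<close> symmetric.\<close>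

definition sandwich_annihilator :: "'a::ring set \<Rightarrow> 'a set" where
  "sandwich_annihilator T = {d. \<forall>t\<in>T. \<forall>s. d * s * t = 0 \<and> t * s * d = 0}"

lemma sandwich_annihilatorI:
  "(\<And>t s. t \<in> T \<Longrightarrow> d * s * t = 0 \<and> t * s * d = 0) \<Longrightarrow> d \<in> sandwich_annihilator T"
  by (simp add: sandwich_annihilator_def)

lemma sandwich_annihilatorD:
  assumes "d \<in> sandwich_annihilator T" "t \<in> T"
  shows "d * s * t = 0" "t * s * d = 0"
  using assms by (simp_all add: sandwich_annihilator_def)

lemma subset_sandwich_annihilator_iff:
  "A \<subseteq> sandwich_annihilator B \<longleftrightarrow> B \<subseteq> sandwich_annihilator A"
  by (auto simp: sandwich_annihilator_def)

lemma ideal_of_sandwich_annihilator: "ideal_of UNIV (sandwich_annihilator T)"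
proof -
  have "d * x \<in> sandwich_annihilator T \<and> x * d \<in> sandwich_annihilator T"
    if "d \<in> sandwich_annihilator T" for d x
  proof -
    have "d * (x * s) * t = 0" "t * s * d * x = 0" "x * (d * s * t) = 0" "t * (s * x) * d = 0"
      if "t \<in> T" for s t
      using sandwich_annihilatorD[OF \<open>d \<in> _\<close> that] by simp_all
    then show ?thesis
      by (simp add: sandwich_annihilator_def mult.assoc)
  qed
  moreover have "additive_subgroup (sandwich_annihilator T)"
    by (simp add: additive_subgroup_def sandwich_annihilator_def left_diff_distrib
        right_diff_distrib)
  ultimately show ?thesis
    by (simp add: ideal_of_UNIV_iff)
qed

text \<open>The ideal \<open>A\<close> generated by \<open>x\<close> satisfies
  \<open>a * s * b = 0\<close> for all \<open>a\<close>, \<open>b\<close> in \<open>A\<close> and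
  every \<open>s\<close>, so it is nilpotent.\<close>

lemma semiprime_elementwise:
  fixes x :: "'a::ring"
  assumes sp: "semiprime_ring TYPE('a)" and x: "\<And>s. x * s * x = 0"
  shows "x = 0"
proof -
  define A where "A = generated_ideal {x}"
  have xA: "x \<in> A"
    using generated_ideal_superset[of "{x}"] by (simp add: A_def)
  have gen: "A \<subseteq> sandwich_annihilator T" if "x \<in> sandwich_annihilator T" for T
    unfolding A_def
    by (rule generated_ideal_minimal) (use that ideal_of_sandwich_annihilator in auto)
  have "x \<in> sandwich_annihilator {x}"
    by (rule sandwich_annihilatorI) (simp add: x)
  \<comment> \<open>Passing from \<open>x\<close> to \<open>A\<close> takes two rounds, one for each
    outer factor; symmetry of the annihilator swaps the factors in between.\<close>
  then have "{x} \<subseteq> sandwich_annihilator A"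
    by (simp only: gen subset_sandwich_annihilator_iff[of "{x}"])
  then have AA: "A \<subseteq> sandwich_annihilator A"
    by (simp add: gen)
  have "ideal_product A A \<subseteq> {p. \<forall>c\<in>A. p * c = 0}"
    unfolding ideal_product_def
    by (rule hull_minimal) (auto simp: sandwich_annihilatorD[OF subsetD[OF AA]]
        additive_subgroup_def left_diff_distrib)
  \<comment> \<open>With the shifted exponent this is the cube of \<open>A\<close>: a product is
    only known to vanish when a third factor stands in the middle.\<close>
  then have "ideal_power_Suc A 2 = {0}"
    by (auto simp: numeral_2_eq_2 intro!: ideal_product_eq_0)
  then have "nilpotent_ideal A"
    unfolding nilpotent_ideal_def A_def using ideal_of_generated_ideal by blast
  then have "A = {0}"
    using sp by (simp add: semiprime_ring_def)
  then show ?thesis using xA by simp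
qed

lemma semiprime_mult_commute_0:
  fixes a b :: "'a::ring"
  assumes "semiprime_ring TYPE('a)" and ab: "\<And>s. a * s * b = 0"
  shows "b * s * a = 0"
proof (rule semiprime_elementwise[OF assms(1)])
  fix t
  have "b * s * a * t * (b * s * a) = b * s * (a * t * b) * s * a"
    by (simp add: mult.assoc)
  then show "b * s * a * t * (b * s * a) = 0" by (simp add: ab)
qed

text \<open>Exchanging \<open>a\<close> and \<open>b\<close> around a middle factor costs a sign.
  Three exchanges give \<open>z * t * z = - (z * t * z)\<close> for
  \<open>z = a * s * b\<close>.\<close>

lemma semiprime_anticommute_0:
  fixes a b :: "'a::ring"
  assumes "semiprime_ring TYPE('a)" and tf: "two_torsion_free TYPE('a)"
    and ab: "\<And>s. a * s * b + b * s * a = 0"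
  shows "a * s * b = 0"
proof (rule semiprime_elementwise[OF assms(1)])
  fix t
  have sw: "b * r * a = - (a * r * b)" for r
    using ab[of r] by (simp add: eq_neg_iff_add_eq_0 add.commute)
  have "a * s * b * t * (a * s * b) = a * s * (b * t * a) * s * b"
    by (simp add: mult.assoc)
  also have "\<dots> = - (a * s * (a * t * b) * s * b)"
    by (simp add: sw)
  also have "\<dots> = - (a * (s * a * t) * b * s * b)"
    by (simp add: mult.assoc)
  also have "\<dots> = b * (s * a * t) * a * s * b"
    by (simp add: sw)
  also have "\<dots> = (b * s * a) * t * (a * s * b)"
    by (simp add: mult.assoc)
  also have "\<dots> = - (a * s * b * t * (a * s * b))"
    by (simp add: sw)
  finally have "a * s * b * t * (a * s * b) + a * s * b * t * (a * s * b) = 0"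
    by (simp add: eq_neg_iff_add_eq_0)
  then show "a * s * b * t * (a * s * b) = 0"
    using tf unfolding two_torsion_free_def by blast
qed

text \<open>Expanding the hypothesis at \<open>x + u\<close> makes the two mixed terms opposite.
  Replacing one of the two factors \<open>f x * s * g u\<close> in the sandwich accordingly creates
  \<open>g u * t * f u\<close>, which is zero.\<close>

lemma semiprime_linearize:
  fixes f g :: "'c::ab_group_add \<Rightarrow> 'a::ring"
  assumes sp: "semiprime_ring TYPE('a)" and "additive f" "additive g"
    and fg: "\<And>x s. f x * s * g x = 0"
  shows "f x * s * g u = 0"
proof (rule semiprime_elementwise[OF sp])
  fix t
  have gf: "g u * r * f u = 0" for r
    by (rule semiprime_mult_commute_0[OF sp fg])
  have "f (x + u) * s * g (x + u) = 0" by (rule fg)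
  then have sw: "f x * s * g u = - (f u * s * g x)"
    by (simp add: additive.add[OF assms(2)] additive.add[OF assms(3)] distrib_left distrib_right
        fg eq_neg_iff_add_eq_0 add.commute)
  have "f x * s * g u * t * (f x * s * g u) = - (f x * s * g u * t * (f u * s * g x))"
    by (subst (2) sw) simp
  also have "\<dots> = - (f x * s * (g u * t * f u) * s * g x)"
    by (simp add: mult.assoc)
  finally have "f x * s * g u * t * (f x * s * g u) = - (f x * s * (g u * t * f u) * s * g x)" .
  then show "f x * s * g u * t * (f x * s * g u) = 0" by (simp add: gf)
qed

section \<open>Jordan homomorphisms\<close>

lemma jordan_hom_additive: "jordan_hom \<phi> \<Longrightarrow> additive \<phi>"
  by (simp add: jordan_hom_def)

lemma jordan_hom_swap:
  assumes "jordan_hom \<phi>"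
  shows "\<phi> (y * x) = \<phi> x * \<phi> y + \<phi> y * \<phi> x - \<phi> (x * y)"
proof -
  interpret additive \<phi> using assms by (rule jordan_hom_additive)
  have sq: "\<phi> (z * z) = \<phi> z * \<phi> z" for z
    using assms by (simp add: jordan_hom_def)
  have "\<phi> ((x + y) * (x + y)) = (\<phi> x + \<phi> y) * (\<phi> x + \<phi> y)"
    by (simp add: sq add)
  moreover have "\<phi> ((x + y) * (x + y)) = \<phi> (x * x) + \<phi> (y * y) + \<phi> (x * y) + \<phi> (y * x)"
    by (simp add: distrib_left distrib_right add)
  ultimately show ?thesis
    by (simp add: sq algebra_simps)
qed

lemma jordan_hom_triple:
  assumes "jordan_hom \<phi>"
  shows "\<phi> (p * w * q) + \<phi> (q * w * p) = \<phi> p * \<phi> w * \<phi> q + \<phi> q * \<phi> w * \<phi> p"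
proof -
  interpret additive \<phi> using assms by (rule jordan_hom_additive)
  have tr: "\<phi> (z * w * z) = \<phi> z * \<phi> w * \<phi> z" for z
    using assms by (simp add: jordan_hom_def)
  have "\<phi> ((p + q) * w * (p + q)) = (\<phi> p + \<phi> q) * \<phi> w * (\<phi> p + \<phi> q)"
    by (simp add: tr add)
  moreover have "\<phi> ((p + q) * w * (p + q))
      = \<phi> (p * w * p) + \<phi> (q * w * q) + \<phi> (p * w * q) + \<phi> (q * w * p)"
    by (simp add: distrib_left distrib_right add)
  ultimately show ?thesis
    by (simp add: tr distrib_left distrib_right add.assoc add.left_commute)
qed

definition hom_defect :: "('a::ring \<Rightarrow> 'b::ring) \<Rightarrow> 'a \<Rightarrow> 'a \<Rightarrow> 'b" where
  "hom_defect \<phi> x y = \<phi> (x * y) - \<phi> x * \<phi> y"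

definition antihom_defect :: "('a::ring \<Rightarrow> 'b::ring) \<Rightarrow> 'a \<Rightarrow> 'a \<Rightarrow> 'b" where
  "antihom_defect \<phi> x y = \<phi> (x * y) - \<phi> y * \<phi> x"

lemma jordan_hom_commutator:
  assumes "jordan_hom \<phi>"
  shows "\<phi> (x * y - y * x) = hom_defect \<phi> x y + antihom_defect \<phi> x y"
  using jordan_hom_swap[OF assms, of y x]
  by (simp add: additive.diff[OF jordan_hom_additive[OF assms]] hom_defect_def
      antihom_defect_def algebra_simps)

lemma additive_defects:
  assumes "additive \<phi>"
  shows "additive (\<lambda>x. hom_defect \<phi> x y)" "additive (hom_defect \<phi> x)"
    "additive (\<lambda>x. antihom_defect \<phi> x y)" "additive (antihom_defect \<phi> x)"
  by (unfold_locales;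
      simp add: hom_defect_def antihom_defect_def additive.add[OF assms] algebra_simps)+

lemma defects_anticommute:
  assumes j: "jordan_hom \<phi>" and "surj \<phi>"
  shows "hom_defect \<phi> x y * s * antihom_defect \<phi> x y
    + antihom_defect \<phi> x y * s * hom_defect \<phi> x y = 0"
proof -
  obtain w where s: "s = \<phi> w" using \<open>surj \<phi>\<close> by blast
  let ?a = "\<phi> x" and ?b = "\<phi> y" and ?c = "\<phi> (x * y)"
  have tr: "\<phi> (u * v * u) = \<phi> u * \<phi> v * \<phi> u" for u v
    using j by (simp add: jordan_hom_def)
  \<comment> \<open>The same element is read as two nested sandwiches and, below, as the linearized
    triple with outer factors \<open>x * y\<close> and \<open>y * x\<close>; eliminating
    \<open>\<phi> (y * x)\<close> then leaves the claim.\<close>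
  have "\<phi> (x * y * w * (y * x)) + \<phi> (y * x * w * (x * y))
      = \<phi> (x * (y * w * y) * x) + \<phi> (y * (x * w * x) * y)"
    by (simp add: mult.assoc)
  also have "\<dots> = ?a * ?b * s * (?b * ?a) + ?b * ?a * s * (?a * ?b)"
    unfolding tr s by (simp add: mult.assoc)
  finally have "?c * s * \<phi> (y * x) + \<phi> (y * x) * s * ?c
      = ?a * ?b * s * (?b * ?a) + ?b * ?a * s * (?a * ?b)"
    by (simp add: jordan_hom_triple[OF j] s)
  then show ?thesis
    unfolding jordan_hom_swap[OF j, of y x] hom_defect_def antihom_defect_def
    by (simp add: algebra_simps)
qed

lemma defects_orthogonal:
  fixes \<phi> :: "'a::ring \<Rightarrow> 'b::ring"
  assumes tf: "two_torsion_free TYPE('b)" and sp: "semiprime_ring TYPE('b)"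
    and j: "jordan_hom \<phi>" and "surj \<phi>"
  shows "hom_defect \<phi> x y * s * antihom_defect \<phi> u v = 0"
proof -
  note add = additive_defects[OF jordan_hom_additive[OF j]]
  have 1: "hom_defect \<phi> x y * s * antihom_defect \<phi> x y = 0" for x y s
    by (rule semiprime_anticommute_0[OF sp tf defects_anticommute[OF j \<open>surj \<phi>\<close>]])
  \<comment> \<open>The first arguments are separated here while \<open>y\<close> stays shared; the
    second arguments follow by linearizing in \<open>y\<close>.\<close>
  have 2: "hom_defect \<phi> x y * s * antihom_defect \<phi> u y = 0" for x u y s
    by (rule semiprime_linearize[OF sp add(1,3) 1])
  show ?thesis
    by (rule semiprime_linearize[OF sp add(2,4) 2])
qed

section \<open>The decomposition\<close>

text \<open>Take the annihilator of \<open>B\<close> and its annihilator in turn; an element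
  \<open>x\<close> of both satisfies \<open>x * s * x = 0\<close> for all \<open>s\<close>.\<close>

lemma separating_ideals:
  fixes A B :: "'a::ring set"
  assumes sp: "semiprime_ring TYPE('a)"
    and AB: "\<And>a s b. a \<in> A \<Longrightarrow> b \<in> B \<Longrightarrow> a * s * b = 0"
  obtains D E where "ideal_of UNIV D" "ideal_of UNIV E" "A \<subseteq> D" "B \<subseteq> E" "D \<inter> E = {0}"
proof
  let ?D = "sandwich_annihilator B" and ?E = "sandwich_annihilator (sandwich_annihilator B)"
  show "ideal_of UNIV ?D" "ideal_of UNIV ?E"
    by (rule ideal_of_sandwich_annihilator)+
  show "A \<subseteq> ?D"
    using semiprime_mult_commute_0[OF sp AB] AB by (blast intro: sandwich_annihilatorI)
  show "B \<subseteq> ?E"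
    by (simp add: subset_sandwich_annihilator_iff[of B])
  have "x = 0" if "x \<in> ?D" "x \<in> ?E" for x
    by (rule semiprime_elementwise[OF sp]) (rule sandwich_annihilatorD(1)[OF that(2,1)])
  moreover have "0 \<in> ?D \<inter> ?E"
    by (simp add: sandwich_annihilator_def)
  ultimately show "?D \<inter> ?E = {0}"
    by blast
qed

theorem corollary3p16:
  fixes \<phi> :: "'a::ring \<Rightarrow> 'b::ring"
  assumes "two_torsion_free TYPE('b)"
    and "semiprime_ring TYPE('b)"
    and "jordan_hom \<phi>"
    and "surj \<phi>"
  shows "sum_of_hom_and_antihom_on \<phi> commutator_ideal"
proof -
  let ?K = "commutator_ideal :: 'a set"
  interpret additive \<phi> using assms(3) by (rule jordan_hom_additive)
  have "a * s * b = 0"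
    if "a \<in> range (\<lambda>(x, y). hom_defect \<phi> x y)" "b \<in> range (\<lambda>(x, y). antihom_defect \<phi> x y)"
    for a s b
    using that defects_orthogonal[OF assms] by auto
  then obtain D E where D: "ideal_of UNIV D" and E: "ideal_of UNIV E"
    and "range (\<lambda>(x, y). hom_defect \<phi> x y) \<subseteq> D"
    and "range (\<lambda>(x, y). antihom_defect \<phi> x y) \<subseteq> E" and DE: "D \<inter> E = {0}"
    by (rule separating_ideals[OF assms(2)])
  then have \<delta>: "\<phi> (x * y) - \<phi> x * \<phi> y \<in> D" and \<epsilon>: "\<phi> (x * y) - \<phi> y * \<phi> x \<in> E" for x y
    unfolding hom_defect_def antihom_defect_def by blast+
  have subD: "additive_subgroup D" and mD: "\<And>d x. d \<in> D \<Longrightarrow> d * x \<in> D \<and> x * d \<in> D"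
    using D by (auto simp: ideal_of_UNIV_iff)
  have subE: "additive_subgroup E" and mE: "\<And>e x. e \<in> E \<Longrightarrow> e * x \<in> E \<and> x * e \<in> E"
    using E by (auto simp: ideal_of_UNIV_iff)
  note addD = additive_subgroup_add[OF subD] and addE = additive_subgroup_add[OF subE]
  note diffD = additive_subgroup_diff[OF subD] and diffE = additive_subgroup_diff[OF subE]
  have uniq: "e = e' \<and> d = d'"
    if "e + d = e' + d'" "e \<in> E" "e' \<in> E" "d \<in> D" "d' \<in> D" for e e' d d'
  proof -
    have "e - e' = d' - d" using that(1) by (simp add: algebra_simps)
    moreover have "e - e' \<in> E" "d' - d \<in> D" using that diffD diffE by auto
    ultimately have "e - e' \<in> D \<inter> E" by simp
    then show ?thesis using DE that(1) by auto
  qed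

  define P where "P = {u. \<exists>e\<in>E. \<exists>d\<in>D. \<phi> u = e + d}"
  have "ideal_of UNIV P"
    unfolding ideal_of_UNIV_iff additive_subgroup_def
  proof (intro conjI ballI allI)
    show "0 \<in> P"
      using additive_subgroup_0[OF subD] additive_subgroup_0[OF subE]
      by (force simp: P_def zero)
  next
    fix u v assume "u \<in> P" "v \<in> P"
    then obtain e d e' d' where *: "e \<in> E" "d \<in> D" "\<phi> u = e + d" "e' \<in> E" "d' \<in> D" "\<phi> v = e' + d'"
      by (auto simp: P_def)
    then have "\<phi> (u - v) = (e - e') + (d - d')" by (simp add: diff)
    then show "u - v \<in> P"
      using * diffD diffE unfolding P_def by blast
  next
    fix u x assume "u \<in> P"
    then obtain e d where *: "e \<in> E" "d \<in> D" "\<phi> u = e + d"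
      by (auto simp: P_def)
    \<comment> \<open>The failure of multiplicativity lies in \<open>D\<close>, so it is absorbed
      into the \<open>D\<close>-component.\<close>
    have "\<phi> (u * x) = e * \<phi> x + (d * \<phi> x + (\<phi> (u * x) - \<phi> u * \<phi> x))"
      by (simp add: * algebra_simps)
    then show "u * x \<in> P"
      using * mE addD mD \<delta> unfolding P_def by blast
    have "\<phi> (x * u) = \<phi> x * e + (\<phi> x * d + (\<phi> (x * u) - \<phi> x * \<phi> u))"
      by (simp add: * algebra_simps)
    then show "x * u \<in> P"
      using * mE addD mD \<delta> unfolding P_def by blast
  qed
  moreover have "x * y - y * x \<in> P" for x y
  proof -
    have "\<phi> (x * y - y * x) = (\<phi> (x * y) - \<phi> y * \<phi> x) + (\<phi> (x * y) - \<phi> x * \<phi> y)"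
      by (simp add: jordan_hom_commutator[OF assms(3)] hom_defect_def antihom_defect_def)
    then show ?thesis
      using \<delta> \<epsilon> unfolding P_def by blast
  qed
  ultimately have KP: "?K \<subseteq> P"
    unfolding commutator_ideal_def by (intro generated_ideal_minimal) auto
  have K: "ideal_of UNIV ?K"
    unfolding commutator_ideal_def by (rule ideal_of_generated_ideal)
  then have Kadd: "\<And>u v. u \<in> ?K \<Longrightarrow> v \<in> ?K \<Longrightarrow> u + v \<in> ?K"
    and Kmult: "\<And>u x. u \<in> ?K \<Longrightarrow> u * x \<in> ?K \<and> x * u \<in> ?K"
    by (auto simp: ideal_of_UNIV_iff additive_subgroup_add)

  have "\<forall>u\<in>?K. \<exists>e d. e \<in> E \<and> d \<in> D \<and> \<phi> u = e + d"
    using KP unfolding P_def by blast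
  then obtain f g where f: "\<And>u. u \<in> ?K \<Longrightarrow> f u \<in> E" and g: "\<And>u. u \<in> ?K \<Longrightarrow> g u \<in> D"
    and fg: "\<And>u. u \<in> ?K \<Longrightarrow> \<phi> u = f u + g u"
    by metis
  \<comment> \<open>As \<open>E + D\<close> is a direct sum, a candidate for one component is
    correct once the remainder of \<open>\<phi> u\<close> lies in the other ideal.\<close>
  have f_eqI: "f u = e" if "u \<in> ?K" "e \<in> E" "\<phi> u - e \<in> D" for u e
    using uniq[of "f u" "g u" e "\<phi> u - e"] that f g fg by simp
  have g_eqI: "g u = d" if "u \<in> ?K" "d \<in> D" "\<phi> u - d \<in> E" for u d
    using uniq[of "f u" "g u" "\<phi> u - d" d] that f g fg by simp

  have f_right: "f (u * x) = f u * \<phi> x" and f_left: "f (x * u) = \<phi> x * f u"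
    and g_right: "g (u * x) = \<phi> x * g u" and g_left: "g (x * u) = g u * \<phi> x"
    if u: "u \<in> ?K" for u x
  proof -
    \<comment> \<open>The identities for \<open>f\<close> compare with \<open>\<phi>\<close> as a
      homomorphism modulo \<open>D\<close>, those for \<open>g\<close> with \<open>\<phi>\<close> as
      an antihomomorphism modulo \<open>E\<close>; hence the reversed order for
      \<open>g\<close>.\<close>
    have eqs: "\<phi> (u * x) - f u * \<phi> x = g u * \<phi> x + (\<phi> (u * x) - \<phi> u * \<phi> x)"
      "\<phi> (x * u) - \<phi> x * f u = \<phi> x * g u + (\<phi> (x * u) - \<phi> x * \<phi> u)"
      "\<phi> (u * x) - \<phi> x * g u = \<phi> x * f u + (\<phi> (u * x) - \<phi> x * \<phi> u)"
      "\<phi> (x * u) - g u * \<phi> x = f u * \<phi> x + (\<phi> (x * u) - \<phi> u * \<phi> x)"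
      by (simp_all add: fg[OF u] algebra_simps)
    have "\<phi> (u * x) - f u * \<phi> x \<in> D" "\<phi> (x * u) - \<phi> x * f u \<in> D"
      "\<phi> (u * x) - \<phi> x * g u \<in> E" "\<phi> (x * u) - g u * \<phi> x \<in> E"
      unfolding eqs by (simp_all add: f[OF u] g[OF u] mD mE addD addE \<delta> \<epsilon>)
    then show "f (u * x) = f u * \<phi> x" "f (x * u) = \<phi> x * f u"
      "g (u * x) = \<phi> x * g u" "g (x * u) = g u * \<phi> x"
      using u Kmult mD mE f g by (auto intro: f_eqI g_eqI)
  qed
  have sum: "f (u + v) = f u + f v \<and> g (u + v) = g u + g v" if "u \<in> ?K" "v \<in> ?K" for u v
  proof (rule uniq)
    have "f (u + v) + g (u + v) = \<phi> u + \<phi> v"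
      using fg[OF Kadd[OF that]] by (simp add: add)
    then show "f (u + v) + g (u + v) = f u + f v + (g u + g v)"
      by (simp add: fg[OF that(1)] fg[OF that(2)] add.assoc add.left_commute)
  qed (simp_all add: that f g Kadd addD addE)
  have orth: "e * d = 0" "d * e = 0" if "e \<in> E" "d \<in> D" for e d
  proof -
    have "e * d \<in> D \<inter> E" "d * e \<in> D \<inter> E"
      using that by (simp_all add: mD mE)
    then show "e * d = 0" "d * e = 0"
      unfolding DE by simp_all
  qed
  \<comment> \<open>Split the factor \<open>\<phi> v\<close> into \<open>f v + g v\<close>; the
    mixed product vanishes because \<open>E\<close> and \<open>D\<close> annihilate each
    other.\<close>
  have f_mult: "f (u * v) = f u * f v" and g_mult: "g (u * v) = g v * g u"
    if "u \<in> ?K" "v \<in> ?K" for u v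
    using f_right[OF that(1), of v] g_right[OF that(1), of v] orth[OF f g] that
    by (simp_all add: fg[OF that(2)] distrib_left distrib_right)
  \<comment> \<open>Surjectivity turns the ideals \<open>E\<close> and \<open>D\<close> of the whole
    ring into ideals of the generated subring, as required of the witnesses.\<close>
  have gen: "generated_subring (range \<phi>) = UNIV"
    using hull_subset[of "range \<phi>" is_subring] \<open>surj \<phi>\<close> by (auto simp: generated_subring_def)
  have "ring_hom_on ?K UNIV f" "ring_antihom_on ?K UNIV g"
    by (simp_all add: ring_hom_on_def ring_antihom_on_def sum f_mult g_mult)
  moreover have "f ` ?K \<subseteq> E" "g ` ?K \<subseteq> D" "E \<inter> D = {0}"
    using f g DE by auto
  ultimately show ?thesis
    unfolding sum_of_hom_and_antihom_on_def gen
    by (intro exI[of _ f] exI[of _ g] conjI exI[of _ E] exI[of _ D] ballI allI D E fg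
        f_right f_left g_right g_left)
qed

end
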